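(* Let $(X_n)_{n\ge1}$ be the elephant random walk with delays with full memory $\mathfrak{M}_n=\{1,2,\ldots,n\}$ and parameters $p,q,r\in(0,1)$, $p+q+r=1$. Let $N_n$ be the number of zero steps and $N^*_n$ the number of nonzero steps among $X_1,\ldots,X_n$, and let $M^*_n=\alpha^*_nN^*_n$ with $\alpha^*_n=\prod_{j=1}^{n-1}\frac{j}{j+1-r}$. Then there exists a random variable $Y$ such that $M^*_n\to Y$ almost surely as $n\to\infty$, and, hence, $$\frac{N^*_n}{n^{1-r}}=\frac{n-N_n}{n^{1-r}}\to\frac{Y}{\Gamma(2-r)}\quad\text{almost surely as }n\to\infty.$$ Moreover, convergence holds in $L^1$ in both cases (that is, for $M^*_n\to Y$ and for $N^*_n/n^{1-r}\to Y/\Gamma(2-r)$); in particular, $$E\Big(\frac{N^*_n}{n^{1-r}}\Big)=E\Big(\frac{n-N_n}{n^{1-r}}\Big)\to\frac{1}{\Gamma(1-r)}\quad\text{as }n\to\infty.$$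
   Context: Elephant random walk with delays, full memory: fix $p,q,r\in(0,1)$ with $p+q+r=1$. The steps $X_1,X_2,\ldots$ take values in $\{-1,0,1\}$. The first step satisfies $P(X_1=1)=p$, $P(X_1=-1)=q$, $P(X_1=0)=r$. For each $n\ge1$, given $X_1,\ldots,X_n$, an index $K$ is chosen uniformly at random from the memory set $\mathfrak{M}_n=\{1,2,\ldots,n\}$ (independently of the past), and, independently of the past and of $K$, the next step is $X_{n+1}=X_K$ with probability $p$, $X_{n+1}=-X_K$ with probability $q$, and $X_{n+1}=0$ with probability $r$. Notation: $I_n=\mathbf{1}_{\{X_n=0\}}$, $N_n=\sum_{k=1}^nI_k$, $I^*_n=\mathbf{1}_{\{X_n\ne0\}}$, $N^*_n=\sum_{k=1}^nI^*_k$, so $N_n+N^*_n=n$. Empty products equal $1$ (so $\alpha^*_1=1$). $\Gamma$ is the Gamma function. *)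

theory Defs
  imports "HOL-Probability.Probability"
begin

text \<open>
  The elephant random walk with delays and full memory. For \<open>n \<ge> 1\<close>, \<open>K n\<close> is the index recalled
  when step \<open>n + 1\<close> is made, and \<open>S n\<close> encodes what is done with it: repeat the recalled step
  (\<open>S n = 1\<close>), reverse it (\<open>S n = -1\<close>), or stay put (\<open>S n = 0\<close>). Sequences are indexed
  from 1; nothing is assumed about \<open>X 0\<close>, \<open>K 0\<close>, \<open>S 0\<close>.

  The past of step \<open>n + 1\<close> is the sigma-algebra generated by \<open>X 1, \<dots>, X n\<close>. Independence is stated
  between generated sigma-algebras because \<open>indep_var\<close> requires both variables to have the
  same value type.
\<close>

locale elephant_walk = prob_space M for M :: "'a measure" +
  fixes p q r :: real
    and X :: "nat \<Rightarrow> 'a \<Rightarrow> int"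
    and K :: "nat \<Rightarrow> 'a \<Rightarrow> nat"
    and S :: "nat \<Rightarrow> 'a \<Rightarrow> int"
  assumes params: "p \<in> {0<..<1}" "q \<in> {0<..<1}" "r \<in> {0<..<1}" "p + q + r = 1"
    and X_rv: "\<And>n. n \<ge> 1 \<Longrightarrow> random_variable (count_space UNIV) (X n)"
    and K_rv: "\<And>n. n \<ge> 1 \<Longrightarrow> random_variable (count_space UNIV) (K n)"
    and S_rv: "\<And>n. n \<ge> 1 \<Longrightarrow> random_variable (count_space UNIV) (S n)"
    and X_values: "\<And>n \<omega>. n \<ge> 1 \<Longrightarrow> \<omega> \<in> space M \<Longrightarrow> X n \<omega> \<in> {-1, 0, 1}"
    and X_first:
      "prob {\<omega> \<in> space M. X 1 \<omega> = 1} = p"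
      "prob {\<omega> \<in> space M. X 1 \<omega> = -1} = q"
      "prob {\<omega> \<in> space M. X 1 \<omega> = 0} = r"
    and K_uniform: "\<And>n. n \<ge> 1 \<Longrightarrow>
      distr M (count_space UNIV) (K n) = measure_pmf (pmf_of_set {1..n})"
    and K_indep: "\<And>n. n \<ge> 1 \<Longrightarrow> indep_set
      (sets (vimage_algebra (space M) (\<lambda>\<omega>. \<lambda>i\<in>{1..n}. X i \<omega>)
        (\<Pi>\<^sub>M i\<in>{1..n}. count_space UNIV)))
      (sets (vimage_algebra (space M) (K n) (count_space UNIV)))"
    and S_law:
      "\<And>n. n \<ge> 1 \<Longrightarrow> prob {\<omega> \<in> space M. S n \<omega> = 1} = p"
      "\<And>n. n \<ge> 1 \<Longrightarrow> prob {\<omega> \<in> space M. S n \<omega> = -1} = q"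
      "\<And>n. n \<ge> 1 \<Longrightarrow> prob {\<omega> \<in> space M. S n \<omega> = 0} = r"
    and S_indep: "\<And>n. n \<ge> 1 \<Longrightarrow> indep_set
      (sets (vimage_algebra (space M) (\<lambda>\<omega>. (\<lambda>i\<in>{1..n}. X i \<omega>, K n \<omega>))
        ((\<Pi>\<^sub>M i\<in>{1..n}. count_space UNIV) \<Otimes>\<^sub>M count_space UNIV)))
      (sets (vimage_algebra (space M) (S n) (count_space UNIV)))"
    and X_step: "\<And>n. n \<ge> 1 \<Longrightarrow> AE \<omega> in M. X (n + 1) \<omega> = S n \<omega> * X (K n \<omega>) \<omega>"

definition zero_steps :: "(nat \<Rightarrow> 'a \<Rightarrow> int) \<Rightarrow> nat \<Rightarrow> 'a \<Rightarrow> real" where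
  "zero_steps X n \<omega> = (\<Sum>k=1..n. of_bool (X k \<omega> = 0))"

definition nonzero_steps :: "(nat \<Rightarrow> 'a \<Rightarrow> int) \<Rightarrow> nat \<Rightarrow> 'a \<Rightarrow> real" where
  "nonzero_steps X n \<omega> = (\<Sum>k=1..n. of_bool (X k \<omega> \<noteq> 0))"

definition alpha_star :: "real \<Rightarrow> nat \<Rightarrow> real" where
  "alpha_star r n = (\<Prod>j=1..n-1. real j / (real j + 1 - r))"

definition M_star :: "real \<Rightarrow> (nat \<Rightarrow> 'a \<Rightarrow> int) \<Rightarrow> nat \<Rightarrow> 'a \<Rightarrow> real" where
  "M_star r X n \<omega> = alpha_star r n * nonzero_steps X n \<omega>"

text \<open>Integrability is required explicitly, as the integral of a non-integrable function is 0.\<close>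

definition tendsto_L1 :: "'a measure \<Rightarrow> (nat \<Rightarrow> 'a \<Rightarrow> real) \<Rightarrow> ('a \<Rightarrow> real) \<Rightarrow> bool" where
  "tendsto_L1 M f g \<longleftrightarrow> (\<forall>n\<ge>1. integrable M (f n)) \<and> integrable M g \<and>
     (\<lambda>n. \<integral>\<omega>. \<bar>f n \<omega> - g \<omega>\<bar> \<partial>M) \<longlonglongrightarrow> 0"

end

theory Submission
  imports Defs
begin

text \<open>
  Testing the conditional law of the next step against the past shows that the martingale
  \<open>M_star r X\<close> has orthogonal increments and that the variance gained after time \<open>n\<close> is at most
  \<open>alpha_star r n\<close>, which is of order \<open>n powr - (1 - r)\<close>. No martingale convergence theorem is needed:
  along the times \<open>Suc k ^ a\<close> with \<open>a\<close> large, the \<open>L\<^sup>1\<close> norms of the increments are summable, which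
  gives almost sure convergence; between two such times the count of nonzero steps is monotone and
  the ratio of the normalising factors tends to 1. Fatou's lemma turns the Cauchy bound into \<open>L\<^sup>1\<close>
  convergence.
\<close>

section \<open>The normalising sequence\<close>

lemma alpha_star_pos: "r < 1 \<Longrightarrow> alpha_star r n > 0"
  unfolding alpha_star_def by (intro prod_pos) (auto intro!: divide_pos_pos)

lemma alpha_star_Suc: 
  assumes "n \<ge> 1"
  shows "alpha_star r (Suc n) = alpha_star r n * (real n / (real n + 1 - r))"
  using assms by (cases n) (simp_all add: alpha_star_def)

text \<open>The mean count grows by the factor \<open>1 + (1 - r) / n\<close> at step
  \<open>n + 1\<close>; the normalisation cancels exactly this factor, which is what makes
  \<open>M_star r X\<close> a martingale.\<close>

lemma alpha_star_Suc_mult: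
  assumes "n \<ge> 1" "r < 1"
  shows "alpha_star r (Suc n) * (1 + (1 - r) / real n) = alpha_star r n"
proof -
  have "1 + (1 - r) / real n = (real n + 1 - r) / real n"
    using assms(1) by (simp add: field_simps)
  moreover have "real n + 1 - r \<noteq> 0" using assms by linarith
  ultimately show ?thesis using assms(1) by (simp add: alpha_star_Suc)
qed

lemma alpha_star_diff:
  assumes "n \<ge> 1" "r < 1"
  shows "alpha_star r n - alpha_star r (Suc n) = alpha_star r (Suc n) * (1 - r) / real n"
  using alpha_star_Suc_mult[OF assms] by (simp add: algebra_simps)

lemma alpha_star_antimono:
  assumes "1 \<le> m" "m \<le> n" "r < 1"
  shows "alpha_star r n \<le> alpha_star r m"
  using assms(2)
proof (induction n rule: dec_induct)
  case (step n)
  have "alpha_star r n - alpha_star r (Suc n) \<ge> 0"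
    unfolding alpha_star_diff[OF order.trans[OF assms(1) step(1)] assms(3)]
    using alpha_star_pos[OF assms(3), of "Suc n"] assms(3) by simp
  with step show ?case by linarith
qed simp

text \<open>The product equals \<open>(n - 1)!\<close> over \<open>(2 - r) * ... * (n - r)\<close>.
  Supplying the missing factor \<open>1 - r\<close> completes the denominator to a Pochhammer
  symbol, the one in Euler's product for Gamma at \<open>1 - r\<close>.\<close>

lemma alpha_star_Gamma_series':
  assumes "n \<ge> 1" "r < 1"
  shows "alpha_star r n * real n powr (1 - r) = (1 - r) * Gamma_series' (1 - r) n"
proof -
  have "alpha_star r n * pochhammer (1 - r) n = (1 - r) * fact (n - 1)"
    using assms(1)
  proof (induction n rule: dec_induct)
    case base
    show ?case by (simp add: alpha_star_def)
  next
    case (step n)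
    have nz: "real n + 1 - r \<noteq> 0" using assms(2) by linarith
    have "alpha_star r (Suc n) * pochhammer (1 - r) (Suc n)
        = alpha_star r n * pochhammer (1 - r) n * real n"
      using nz by (simp add: alpha_star_Suc[OF step(1)] pochhammer_Suc field_simps)
    also have "\<dots> = (1 - r) * fact (Suc n - 1)"
      using step by (simp add: step.IH fact_num_eq_if)
    finally show ?case .
  qed
  moreover have "pochhammer (1 - r) n > 0" using assms(2) by (intro pochhammer_pos) simp
  ultimately have "alpha_star r n = (1 - r) * fact (n - 1) / pochhammer (1 - r) n"
    by (simp add: eq_divide_eq)
  then show ?thesis using assms by (simp add: Gamma_series'_def powr_def)
qed

lemma alpha_star_asymp:
  assumes "r < 1"
  shows "(\<lambda>n. alpha_star r n * real n powr (1 - r)) \<longlonglongrightarrow> Gamma (2 - r)"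
proof -
  have "1 - r \<notin> \<int>\<^sub>\<le>\<^sub>0" using assms by (auto elim!: nonpos_Ints_cases)
  then have "(\<lambda>n. (1 - r) * Gamma_series' (1 - r) n) \<longlonglongrightarrow> (1 - r) * Gamma (1 - r)"
    by (intro tendsto_intros Gamma_series'_LIMSEQ)
  \<comment> \<open>The extra factor \<open>1 - r\<close> is absorbed by the functional equation,
    hence the argument \<open>2 - r\<close>.\<close>
  also have "(1 - r) * Gamma (1 - r) = Gamma (2 - r)"
    using Gamma_plus1[OF \<open>1 - r \<notin> \<int>\<^sub>\<le>\<^sub>0\<close>] by simp
  finally show ?thesis
  proof (rule Lim_transform_eventually)
    show "\<forall>\<^sub>F n in sequentially. (1 - r) * Gamma_series' (1 - r) n
        = alpha_star r n * real n powr (1 - r)"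
      using eventually_ge_at_top[of 1]
      by eventually_elim (simp add: alpha_star_Gamma_series' assms)
  qed
qed

lemma alpha_star_tendsto_0:
  assumes "r < 1"
  shows "alpha_star r \<longlonglongrightarrow> 0"
proof -
  have "(\<lambda>n. real n powr - (1 - r)) \<longlonglongrightarrow> 0"
    using assms by (intro tendsto_neg_powr filterlim_real_sequentially) simp
  from tendsto_mult[OF alpha_star_asymp[OF assms] this]
  have "(\<lambda>n. alpha_star r n * real n powr (1 - r) * real n powr - (1 - r)) \<longlonglongrightarrow> 0"
    by simp
  then show ?thesis
  proof (rule Lim_transform_eventually)
    show "\<forall>\<^sub>F n in sequentially. alpha_star r n * real n powr (1 - r) * real n powr - (1 - r)
        = alpha_star r n"
      using eventually_gt_at_top[of 0] by eventually_elim (simp add: mult.assoc flip: powr_add)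
  qed
qed

text \<open>Along the times \<open>Suc k ^ a\<close> the factor is of order
  \<open>k powr - (a * (1 - r))\<close>. The threshold 4 makes its square root at most of order
  \<open>1 / k^2\<close>.\<close>

lemma alpha_star_sqrt_summable:
  assumes "r < 1" "real a * (1 - r) \<ge> 4"
  shows "summable (\<lambda>k. sqrt (alpha_star r (Suc k ^ a)))"
proof -
  from convergent_imp_Bseq[OF convergentI[OF alpha_star_asymp[OF assms(1)]]]
  obtain C where C: "C > 0" "\<And>n. norm (alpha_star r n * real n powr (1 - r)) \<le> C"
    by (auto simp: Bseq_def)
  have le: "sqrt (alpha_star r (Suc k ^ a)) \<le> sqrt C * inverse (real (Suc k) ^ 2)" for k
  proof -
    let ?x = "real (Suc k)"
    have "alpha_star r (Suc k ^ a) * ?x ^ 4 = alpha_star r (Suc k ^ a) * ?x powr 4"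
      by (simp add: powr_numeral)
    also have "\<dots> \<le> alpha_star r (Suc k ^ a) * ?x powr (real a * (1 - r))"
      using assms alpha_star_pos[OF assms(1), of "Suc k ^ a"]
      by (intro mult_left_mono powr_mono) auto
    also have "?x powr (real a * (1 - r)) = real (Suc k ^ a) powr (1 - r)"
      by (simp add: powr_powr flip: powr_realpow)
    also have "alpha_star r (Suc k ^ a) * \<dots> \<le> C"
      using C(2)[of "Suc k ^ a"] by simp
    finally have "alpha_star r (Suc k ^ a) \<le> C * inverse (?x ^ 2) ^ 2"
      by (simp add: field_simps)
    then have "sqrt (alpha_star r (Suc k ^ a)) \<le> sqrt (C * inverse (?x ^ 2) ^ 2)"
      by (rule real_sqrt_le_mono)
    then show ?thesis by (simp add: real_sqrt_mult)
  qed
  have "summable (\<lambda>k. sqrt C * inverse (real (Suc k) ^ 2))"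
    using inverse_power_summable[of 2, where ?'a = real]
    by (intro summable_mult) (subst summable_Suc_iff, simp)
  then show ?thesis
    by (rule summable_comparison_test'[where N = 0])
      (use le alpha_star_pos[OF assms(1)] in \<open>simp add: less_imp_le\<close>)
qed

text \<open>The times grow polynomially, so consecutive ones have ratio tending to 1, and the
  factors inherit this. Along geometric times the limit would be below 1 and interpolation between
  the times would fail.\<close>

lemma alpha_star_ratio:
  assumes "r < 1" "a \<ge> 1"
  shows "(\<lambda>k. alpha_star r (Suc (Suc k) ^ a) / alpha_star r (Suc k ^ a)) \<longlonglongrightarrow> 1"
proof -
  define c where "c = (\<lambda>n. alpha_star r n * real n powr (1 - r))"
  have G: "Gamma (2 - r) > 0" using assms(1) by (intro Gamma_real_pos) simp
  have fl: "filterlim (\<lambda>k. Suc k ^ a) sequentially sequentially"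
    using assms(2) by (intro filterlim_subseq) (auto simp: strict_mono_def intro!: power_strict_mono)
  have c1: "(\<lambda>k. c (Suc k ^ a)) \<longlonglongrightarrow> Gamma (2 - r)"
    using filterlim_compose[OF alpha_star_asymp[OF assms(1)] fl] by (simp add: c_def)
  have c2: "(\<lambda>k. c (Suc (Suc k) ^ a)) \<longlonglongrightarrow> Gamma (2 - r)"
    using LIMSEQ_Suc[OF c1] by simp
  have "(\<lambda>k. real (Suc k) / real (Suc (Suc k))) \<longlonglongrightarrow> 1"
    using LIMSEQ_Suc[OF LIMSEQ_n_over_Suc_n] by simp
  then have "(\<lambda>k. ((real (Suc k) / real (Suc (Suc k))) ^ a) powr (1 - r)) \<longlonglongrightarrow> (1 ^ a) powr (1 - r)"
    by (intro tendsto_powr tendsto_power tendsto_const) simp_all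
  from tendsto_mult[OF tendsto_divide[OF c2 c1] this]
  have "(\<lambda>k. c (Suc (Suc k) ^ a) / c (Suc k ^ a)
      * ((real (Suc k) / real (Suc (Suc k))) ^ a) powr (1 - r)) \<longlonglongrightarrow> 1"
    using G by simp
  moreover have "c (Suc (Suc k) ^ a) / c (Suc k ^ a)
      * ((real (Suc k) / real (Suc (Suc k))) ^ a) powr (1 - r)
      = alpha_star r (Suc (Suc k) ^ a) / alpha_star r (Suc k ^ a)" for k
  proof -
    \<comment> \<open>Abbreviating the two times lets the factors \<open>x powr (1 - r)\<close> and
      \<open>y powr (1 - r)\<close> cancel without their powers being expanded.\<close>
    define x where "x = real (Suc k ^ a)"
    define y where "y = real (Suc (Suc k) ^ a)"
    have "x > 0" "y > 0" by (simp_all add: x_def y_def)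
    moreover have "(real (Suc k) / real (Suc (Suc k))) ^ a = x / y"
      by (simp add: x_def y_def power_divide)
    ultimately show ?thesis
      by (simp only: c_def powr_divide flip: x_def y_def) simp
  qed
  ultimately show ?thesis by simp
qed

section \<open>Convergence from a subsequence\<close>

lemma tendsto_between_subseq:
  fixes x u v :: "nat \<Rightarrow> real"
  assumes g: "strict_mono g"
    and lim: "u \<longlonglongrightarrow> L" "v \<longlonglongrightarrow> L"
    and le: "\<And>k n. g k \<le> n \<Longrightarrow> n \<le> g (Suc k) \<Longrightarrow> u k \<le> x n \<and> x n \<le> v k"
  shows "x \<longlonglongrightarrow> L"
proof (rule LIMSEQ_I)
  fix e :: real assume "e > 0"
  then have "\<forall>\<^sub>F k in sequentially. norm (u k - L) < e \<and> norm (v k - L) < e"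
    using lim by (intro eventually_conj) (auto simp: tendsto_iff dist_norm)
  then obtain k0 where k0: "\<And>k. k \<ge> k0 \<Longrightarrow> norm (u k - L) < e \<and> norm (v k - L) < e"
    by (auto simp: eventually_sequentially)
  have "norm (x n - L) < e" if "n \<ge> g k0" for n
  proof -
    \<comment> \<open>The block containing \<open>n\<close> is found as the last \<open>k\<close>
      with \<open>g k\<close> \<le> \<open>n\<close>. The set is finite because a strictly
      increasing \<open>g\<close> satisfies \<open>k\<close> \<le> \<open>g k\<close>, and it
      contains \<open>k0\<close>.\<close>
    define k where "k = Max {k. g k \<le> n}"
    have "{k. g k \<le> n} \<subseteq> {..n}"
      using strict_mono_imp_increasing[OF g] by (auto intro: order_trans)
    then have fin: "finite {k. g k \<le> n}" by (rule finite_subset) simp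
    have "k \<ge> k0" unfolding k_def using fin that by (intro Max_ge) auto
    have "g k \<le> n" using Max_in[OF fin] that by (auto simp: k_def)
    have "g (Suc k) > n"
    proof (rule ccontr)
      assume "\<not> g (Suc k) > n"
      then have "Suc k \<le> k" unfolding k_def using fin by (intro Max_ge) auto
      then show False by simp
    qed
    with le[OF \<open>g k \<le> n\<close>] k0[OF \<open>k \<ge> k0\<close>] show ?thesis
      by (auto simp: abs_less_iff)
  qed
  then show "\<exists>no. \<forall>n\<ge>no. norm (x n - L) < e" by blast
qed

section \<open>Almost sure and L1 convergence criteria\<close>

lemma (in finite_measure) AE_convergent_summable_L1:
  fixes f :: "nat \<Rightarrow> 'a \<Rightarrow> real"
  assumes f: "\<And>k. integrable M (f k)"
    and b: "\<And>k. (\<integral>x. \<bar>f (Suc k) x - f k x\<bar> \<partial>M) \<le> b k" "summable b"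
  shows "AE x in M. convergent (\<lambda>k. f k x)"
proof -
  have [measurable]: "f k \<in> borel_measurable M" for k using f by simp
  have b_nonneg: "b k \<ge> 0" for k
    by (rule order.trans[OF _ b(1)]) simp
  \<comment> \<open>The total variation of the sequence has finite integral, so it is finite almost
    everywhere, and the increments are then absolutely summable.\<close>
  have "(\<integral>\<^sup>+x. (\<Sum>k. ennreal \<bar>f (Suc k) x - f k x\<bar>) \<partial>M)
      = (\<Sum>k. \<integral>\<^sup>+x. ennreal \<bar>f (Suc k) x - f k x\<bar> \<partial>M)"
    by (rule nn_integral_suminf) simp
  also have "\<dots> = (\<Sum>k. ennreal (\<integral>x. \<bar>f (Suc k) x - f k x\<bar> \<partial>M))"
    using f by (subst nn_integral_eq_integral) auto
  also have "\<dots> \<le> (\<Sum>k. ennreal (b k))"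
    using b(1) by (intro suminf_le ennreal_leI) auto
  also have "\<dots> < \<infinity>" using b(2) b_nonneg by (simp add: suminf_ennreal2 less_top)
  finally have "AE x in M. (\<Sum>k. ennreal \<bar>f (Suc k) x - f k x\<bar>) \<noteq> \<infinity>"
    by (intro nn_integral_PInf_AE) auto
  then show ?thesis
  proof eventually_elim
    case (elim x)
    then have "summable (\<lambda>k. \<bar>f (Suc k) x - f k x\<bar>)"
      by (intro summable_suminf_not_top) auto
    then have "summable (\<lambda>k. f (Suc k) x - f k x)"
      by (rule summable_rabs_cancel)
    then have "convergent (\<lambda>n. \<Sum>k<n. f (Suc k) x - f k x)"
      by (simp add: summable_iff_convergent)
    then have "convergent (\<lambda>n. (f n x - f 0 x) + f 0 x)"
      by (intro convergent_add convergent_const) (simp add: sum_lessThan_telescope[of "\<lambda>k. f k x"])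
    then show ?case by simp
  qed
qed

text \<open>Fatou's lemma applied to the distances from a fixed \<open>h\<close>. Integrability of
  the limit comes out of the same bound, since \<open>h\<close> and \<open>h - Y\<close> are
  integrable.\<close>

lemma L1_dist_limit_le:
  fixes f :: "nat \<Rightarrow> 'a \<Rightarrow> real"
  assumes f: "\<And>k. integrable M (f k)" and h: "integrable M h"
    and Y: "Y \<in> borel_measurable M" and lim: "AE x in M. (\<lambda>k. f k x) \<longlonglongrightarrow> Y x"
    and c: "\<forall>\<^sub>F k in sequentially. (\<integral>x. \<bar>h x - f k x\<bar> \<partial>M) \<le> c" "c \<ge> 0"
  shows "integrable M Y" "(\<integral>x. \<bar>h x - Y x\<bar> \<partial>M) \<le> c"
proof -
  have [measurable]: "f k \<in> borel_measurable M" "h \<in> borel_measurable M"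
    "Y \<in> borel_measurable M" for k using f h Y by simp_all
  have "AE x in M. ennreal \<bar>h x - Y x\<bar> = liminf (\<lambda>k. ennreal \<bar>h x - f k x\<bar>)"
    using lim
  proof eventually_elim
    case (elim x)
    then have "(\<lambda>k. ennreal \<bar>h x - f k x\<bar>) \<longlonglongrightarrow> ennreal \<bar>h x - Y x\<bar>"
      by (intro tendsto_intros)
    then show ?case by (intro lim_imp_Liminf[symmetric]) simp_all
  qed
  then have "(\<integral>\<^sup>+x. ennreal \<bar>h x - Y x\<bar> \<partial>M) = (\<integral>\<^sup>+x. liminf (\<lambda>k. ennreal \<bar>h x - f k x\<bar>) \<partial>M)"
    by (rule nn_integral_cong_AE)
  also have "\<dots> \<le> liminf (\<lambda>k. \<integral>\<^sup>+x. ennreal \<bar>h x - f k x\<bar> \<partial>M)"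
    by (rule nn_integral_liminf) simp
  also have "\<dots> = liminf (\<lambda>k. ennreal (\<integral>x. \<bar>h x - f k x\<bar> \<partial>M))"
    using f h by (subst nn_integral_eq_integral) auto
  also have "\<dots> \<le> liminf (\<lambda>k. ennreal c)"
    using c(1) by (intro Liminf_mono) (auto elim!: eventually_mono intro: ennreal_leI)
  also have "\<dots> = ennreal c" by (simp add: Liminf_const)
  finally have le: "(\<integral>\<^sup>+x. ennreal \<bar>h x - Y x\<bar> \<partial>M) \<le> ennreal c" .
  then have int: "integrable M (\<lambda>x. h x - Y x)"
    by (intro integrableI_bounded) (auto intro: le_less_trans)
  from Bochner_Integration.integrable_diff[OF h this] show "integrable M Y" by simp
  from le show "(\<integral>x. \<bar>h x - Y x\<bar> \<partial>M) \<le> c"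
    using int c(2) by (subst (asm) nn_integral_eq_integral) (auto simp: ennreal_le_iff)
qed

lemma tendsto_L1_divide:
  assumes f: "tendsto_L1 M f g" and c: "c \<longlonglongrightarrow> l" "l \<noteq> 0"
  shows "tendsto_L1 M (\<lambda>n x. f n x / c n) (\<lambda>x. g x / l)"
  unfolding tendsto_L1_def
proof (intro conjI allI impI)
  have int: "\<And>n. n \<ge> 1 \<Longrightarrow> integrable M (f n)" "integrable M g"
    and lim: "(\<lambda>n. \<integral>x. \<bar>f n x - g x\<bar> \<partial>M) \<longlonglongrightarrow> 0"
    using f by (auto simp: tendsto_L1_def)
  show "integrable M (\<lambda>x. f n x / c n)" if "n \<ge> 1" for n using int(1)[OF that] by simp
  show "integrable M (\<lambda>x. g x / l)" using int(2) by simp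
  define B where "B n = (\<integral>x. \<bar>f n x - g x\<bar> \<partial>M) / \<bar>c n\<bar> + (\<integral>x. \<bar>g x\<bar> \<partial>M) * \<bar>1 / c n - 1 / l\<bar>" for n
  have "B \<longlonglongrightarrow> 0 / \<bar>l\<bar> + (\<integral>x. \<bar>g x\<bar> \<partial>M) * \<bar>1 / l - 1 / l\<bar>"
    unfolding B_def using c by (intro tendsto_intros lim) auto
  then have B: "B \<longlonglongrightarrow> 0" by simp
  have le: "(\<integral>x. \<bar>f n x / c n - g x / l\<bar> \<partial>M) \<le> B n" if "n \<ge> 1" for n
  proof -
    have "(\<integral>x. \<bar>f n x / c n - g x / l\<bar> \<partial>M)
        \<le> (\<integral>x. \<bar>f n x - g x\<bar> / \<bar>c n\<bar> + \<bar>g x\<bar> * \<bar>1 / c n - 1 / l\<bar> \<partial>M)"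
    proof (rule integral_mono)
      show "\<bar>f n x / c n - g x / l\<bar> \<le> \<bar>f n x - g x\<bar> / \<bar>c n\<bar> + \<bar>g x\<bar> * \<bar>1 / c n - 1 / l\<bar>" for x
      proof -
        \<comment> \<open>One term for the error in \<open>f n\<close>, one for the error in the
          scaling. The identity also holds when \<open>c n = 0\<close>, because division by zero
          gives 0.\<close>
        have "f n x / c n - g x / l = (f n x - g x) / c n + g x * (1 / c n - 1 / l)"
          by (simp add: diff_divide_distrib right_diff_distrib)
        then show ?thesis
          using abs_triangle_ineq[of "(f n x - g x) / c n" "g x * (1 / c n - 1 / l)"]
          by (simp add: abs_mult)
      qed
    qed (use int(1)[OF that] int(2) in auto)
    also have "\<dots> = B n" unfolding B_def using int(1)[OF that] int(2) by simp
    finally show ?thesis .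
  qed
  show "(\<lambda>n. \<integral>x. \<bar>f n x / c n - g x / l\<bar> \<partial>M) \<longlonglongrightarrow> 0"
  proof (rule tendsto_sandwich[OF _ _ tendsto_const B])
    show "\<forall>\<^sub>F n in sequentially. 0 \<le> (\<integral>x. \<bar>f n x / c n - g x / l\<bar> \<partial>M)" by simp
    show "\<forall>\<^sub>F n in sequentially. (\<integral>x. \<bar>f n x / c n - g x / l\<bar> \<partial>M) \<le> B n"
      using eventually_ge_at_top[of 1] by eventually_elim (rule le)
  qed
qed

text \<open>Nonnegativity of the variance of the absolute value gives this case of the
  Cauchy-Schwarz inequality.\<close>

lemma (in prob_space) expectation_abs_le_sqrt:
  fixes f :: "'a \<Rightarrow> real"
  assumes "integrable M f" "integrable M (\<lambda>x. (f x)\<^sup>2)" "expectation (\<lambda>x. (f x)\<^sup>2) \<le> c"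
  shows "expectation (\<lambda>x. \<bar>f x\<bar>) \<le> sqrt c"
proof (rule real_le_rsqrt)
  have "0 \<le> variance (\<lambda>x. \<bar>f x\<bar>)" by (rule variance_positive)
  also have "\<dots> = expectation (\<lambda>x. (f x)\<^sup>2) - (expectation (\<lambda>x. \<bar>f x\<bar>))\<^sup>2"
    using assms(1,2) by (subst variance_eq) auto
  finally show "(expectation (\<lambda>x. \<bar>f x\<bar>))\<^sup>2 \<le> c" using assms(3) by simp
qed

section \<open>Moments of the number of nonzero steps\<close>

lemma nonzero_steps_Suc:
  "nonzero_steps X (Suc n) \<omega> = nonzero_steps X n \<omega> + of_bool (X (Suc n) \<omega> \<noteq> 0)"
  by (simp add: nonzero_steps_def)

lemma nonzero_steps_mono: "m \<le> n \<Longrightarrow> nonzero_steps X m \<omega> \<le> nonzero_steps X n \<omega>"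
  unfolding nonzero_steps_def by (intro sum_mono2) auto

lemma nonzero_steps_nonneg: "0 \<le> nonzero_steps X n \<omega>"
  unfolding nonzero_steps_def by (intro sum_nonneg) auto

lemma nonzero_steps_le: "nonzero_steps X n \<omega> \<le> real n"
  using sum_bounded_above[of "{1..n}" "\<lambda>k. of_bool (X k \<omega> \<noteq> 0)" "1::real"]
  by (simp add: nonzero_steps_def)

lemma nonzero_steps_eq_diff: "nonzero_steps X n \<omega> = real n - zero_steps X n \<omega>"
proof -
  have "nonzero_steps X n \<omega> + zero_steps X n \<omega> = (\<Sum>k=1..n. 1)"
    unfolding nonzero_steps_def zero_steps_def sum.distrib[symmetric]
    by (intro sum.cong) auto
  then show ?thesis by simp
qed

section \<open>The law of the next step given the past\<close>

context elephant_walk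
begin

lemma r_less_1: "r < 1"
  using params by simp

abbreviation past :: "nat \<Rightarrow> 'a set set" where
  "past n \<equiv> sets (vimage_algebra (space M) (\<lambda>\<omega>. \<lambda>i\<in>{1..n}. X i \<omega>)
     (\<Pi>\<^sub>M i\<in>{1..n}. count_space UNIV))"

abbreviation past_choice :: "nat \<Rightarrow> 'a set set" where
  "past_choice n \<equiv> sets (vimage_algebra (space M) (\<lambda>\<omega>. (\<lambda>i\<in>{1..n}. X i \<omega>, K n \<omega>))
     ((\<Pi>\<^sub>M i\<in>{1..n}. count_space UNIV) \<Otimes>\<^sub>M count_space UNIV))"

lemma nonzero_in_past:
  assumes "i \<in> {1..n}"
  shows "{\<omega> \<in> space M. X i \<omega> \<noteq> 0} \<in> past n"
proof -
  have "(\<lambda>f. f i) -` {0} \<inter> space (\<Pi>\<^sub>M i\<in>{1..n}. count_space (UNIV :: int set))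
      \<in> sets (\<Pi>\<^sub>M i\<in>{1..n}. count_space UNIV)"
    using assms by (intro measurable_sets[OF measurable_component_singleton]) auto
  then have "(\<lambda>\<omega>. \<lambda>i\<in>{1..n}. X i \<omega>) -` (space (\<Pi>\<^sub>M i\<in>{1..n}. count_space UNIV)
      - (\<lambda>f. f i) -` {0} \<inter> space (\<Pi>\<^sub>M i\<in>{1..n}. count_space UNIV)) \<inter> space M \<in> past n"
    by (intro in_vimage_algebra sets.compl_sets)
  also have "(\<lambda>\<omega>. \<lambda>i\<in>{1..n}. X i \<omega>) -` (space (\<Pi>\<^sub>M i\<in>{1..n}. count_space UNIV)
      - (\<lambda>f. f i) -` {0} \<inter> space (\<Pi>\<^sub>M i\<in>{1..n}. count_space UNIV)) \<inter> space M
      = {\<omega> \<in> space M. X i \<omega> \<noteq> 0}"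
    using assms by (auto simp: space_PiM)
  finally show ?thesis .
qed

text \<open>\<open>S_indep\<close> refers to the joint sigma-algebra of past and recalled index.
  Such an intersection belongs to it as the preimage of a rectangle
  \<open>B \<times> {k}\<close>.\<close>

lemma past_inter_choice:
  assumes "A \<in> past n"
  shows "A \<inter> {\<omega> \<in> space M. K n \<omega> = k} \<in> past_choice n"
proof -
  let ?P = "\<Pi>\<^sub>M i\<in>{1..n}. count_space (UNIV :: int set)"
  from assms obtain B where B: "B \<in> sets ?P" "A = (\<lambda>\<omega>. \<lambda>i\<in>{1..n}. X i \<omega>) -` B \<inter> space M"
    by (subst (asm) sets_vimage_algebra2) (auto simp: space_PiM)
  have "(\<lambda>\<omega>. (\<lambda>i\<in>{1..n}. X i \<omega>, K n \<omega>)) -` (B \<times> {k}) \<inter> space M \<in> past_choice n"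
    using B(1) by (intro in_vimage_algebra) auto
  also have "(\<lambda>\<omega>. (\<lambda>i\<in>{1..n}. X i \<omega>, K n \<omega>)) -` (B \<times> {k}) \<inter> space M
      = A \<inter> {\<omega> \<in> space M. K n \<omega> = k}"
    using B(2) by auto
  finally show ?thesis .
qed

text \<open>That the past consists of events is part of \<open>indep_set\<close>, so it is read off
  from \<open>K_indep\<close>.\<close>

lemma past_events: "n \<ge> 1 \<Longrightarrow> A \<in> past n \<Longrightarrow> A \<in> events"
  using K_indep[of n] by (auto simp: indep_set_def indep_sets_def split: bool.splits)

lemma nonzero_events [measurable]: "i \<ge> 1 \<Longrightarrow> {\<omega> \<in> space M. X i \<omega> \<noteq> 0} \<in> events"
  by (rule past_events[OF _ nonzero_in_past]) auto

lemma prob_choice: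
  assumes "n \<ge> 1" "k \<in> {1..n}"
  shows "prob {\<omega> \<in> space M. K n \<omega> = k} = 1 / real n"
proof -
  have "prob {\<omega> \<in> space M. K n \<omega> = k} = measure (distr M (count_space UNIV) (K n)) {k}"
    using K_rv[OF assms(1)] by (subst measure_distr) (auto intro!: arg_cong[where f = prob])
  also have "\<dots> = 1 / real n"
    using assms by (simp add: K_uniform measure_pmf_single)
  finally show ?thesis .
qed

lemma AE_choice:
  assumes "n \<ge> 1"
  shows "AE \<omega> in M. K n \<omega> \<in> {1..n}"
proof -
  have "AE k in measure_pmf (pmf_of_set {1..n}). k \<in> {1..n}"
    using assms by (simp add: AE_measure_pmf_iff del: atLeastAtMost_iff)
  then have "AE k in distr M (count_space UNIV) (K n). k \<in> {1..n}"
    by (simp only: K_uniform[OF assms])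
  then show ?thesis using K_rv[OF assms] by (subst (asm) AE_distr_iff) auto
qed

text \<open>Repeating and reversing a step preserve being nonzero alike, so for the counts only the
  event \<open>S n \<noteq> 0\<close> matters.\<close>

lemma prob_move:
  assumes "n \<ge> 1"
  shows "prob {\<omega> \<in> space M. S n \<omega> \<noteq> 0} = 1 - r"
proof -
  have [measurable]: "S n \<in> measurable M (count_space UNIV)" using S_rv[OF assms] .
  have "prob {\<omega> \<in> space M. \<not> S n \<omega> = 0} = 1 - prob {\<omega> \<in> space M. S n \<omega> = 0}"
    by (rule prob_neg) measurable
  then show ?thesis using S_law(3)[OF assms] by simp
qed

text \<open>Two independences in turn: the action \<open>S n\<close> is split off from past and
  index together, then the index from the past.\<close>

lemma prob_past_choice_move:
  assumes n: "n \<ge> 1" and A: "A \<in> past n" and k: "k \<in> {1..n}"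
  shows "prob (A \<inter> {\<omega> \<in> space M. K n \<omega> = k} \<inter> {\<omega> \<in> space M. S n \<omega> \<noteq> 0})
    = prob A * (1 - r) / real n"
proof -
  have "(S n) -` (-{0}) \<inter> space M \<in> sets (vimage_algebra (space M) (S n) (count_space UNIV))"
    by (intro in_vimage_algebra) auto
  also have "(S n) -` (-{0}) \<inter> space M = {\<omega> \<in> space M. S n \<omega> \<noteq> 0}" by auto
  finally have "prob (A \<inter> {\<omega> \<in> space M. K n \<omega> = k} \<inter> {\<omega> \<in> space M. S n \<omega> \<noteq> 0})
    = prob (A \<inter> {\<omega> \<in> space M. K n \<omega> = k}) * prob {\<omega> \<in> space M. S n \<omega> \<noteq> 0}"
    by (rule indep_setD[OF S_indep[OF n] past_inter_choice[OF A]])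
  moreover have "(K n) -` {k} \<inter> space M
      \<in> sets (vimage_algebra (space M) (K n) (count_space UNIV))"
    by (intro in_vimage_algebra) auto
  then have "{\<omega> \<in> space M. K n \<omega> = k} \<in> sets (vimage_algebra (space M) (K n) (count_space UNIV))"
    by (simp add: vimage_def Int_def conj_commute)
  from indep_setD[OF K_indep[OF n] A this]
  have "prob (A \<inter> {\<omega> \<in> space M. K n \<omega> = k}) = prob A * prob {\<omega> \<in> space M. K n \<omega> = k}" .
  ultimately show ?thesis
    by (simp add: prob_choice[OF n k] prob_move[OF n])
qed

text \<open>Split according to the recalled index \<open>k\<close>: the next step is nonzero exactly
  when the action is a move and \<open>X k\<close> is nonzero. Since \<open>X k\<close> belongs to
  the past, its condition can be merged into \<open>A\<close>.\<close>

lemma prob_next_nonzero: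
  assumes n: "n \<ge> 1" and A: "A \<in> past n"
  shows "prob (A \<inter> {\<omega> \<in> space M. X (Suc n) \<omega> \<noteq> 0})
    = (1 - r) / real n * (\<Sum>k=1..n. prob (A \<inter> {\<omega> \<in> space M. X k \<omega> \<noteq> 0}))"
proof -
  define B where "B k = (A \<inter> {\<omega> \<in> space M. X k \<omega> \<noteq> 0}) \<inter> {\<omega> \<in> space M. K n \<omega> = k}
    \<inter> {\<omega> \<in> space M. S n \<omega> \<noteq> 0}" for k
  have AX: "A \<inter> {\<omega> \<in> space M. X k \<omega> \<noteq> 0} \<in> past n" if "k \<in> {1..n}" for k
    using A nonzero_in_past[OF that] by (rule sets.Int)
  have [measurable]: "K n \<in> measurable M (count_space UNIV)" "S n \<in> measurable M (count_space UNIV)"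
    using K_rv[OF n] S_rv[OF n] by auto
  have B_events: "B k \<in> events" if "k \<in> {1..n}" for k
  proof -
    have "{\<omega> \<in> space M. K n \<omega> = k} \<in> events" "{\<omega> \<in> space M. S n \<omega> \<noteq> 0} \<in> events"
      by measurable
    then show ?thesis unfolding B_def using past_events[OF n AX[OF that]] by blast
  qed
  \<comment> \<open>The two events agree only almost surely, as both the recursion for
    \<open>X\<close> and the range of \<open>K n\<close> hold only almost everywhere.\<close>
  have "prob (A \<inter> {\<omega> \<in> space M. X (Suc n) \<omega> \<noteq> 0}) = prob (\<Union>k\<in>{1..n}. B k)"
  proof (rule finite_measure_eq_AE)
    show "AE \<omega> in M. (\<omega> \<in> A \<inter> {\<omega> \<in> space M. X (Suc n) \<omega> \<noteq> 0}) = (\<omega> \<in> (\<Union>k\<in>{1..n}. B k))"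
      using X_step[OF n] AE_choice[OF n] AE_space
      by eventually_elim (auto simp: B_def)
    show "A \<inter> {\<omega> \<in> space M. X (Suc n) \<omega> \<noteq> 0} \<in> events"
      using past_events[OF n A] by (intro sets.Int nonzero_events) auto
  qed (use B_events in auto)
  also have "\<dots> = (\<Sum>k\<in>{1..n}. prob (B k))"
    using B_events by (intro finite_measure_finite_Union) (auto simp: disjoint_family_on_def B_def)
  also have "\<dots> = (\<Sum>k\<in>{1..n}. (1 - r) / real n * prob (A \<inter> {\<omega> \<in> space M. X k \<omega> \<noteq> 0}))"
    unfolding B_def by (intro sum.cong refl) (simp add: prob_past_choice_move[OF n AX])
  finally show ?thesis by (simp add: sum_distrib_left)
qed

section \<open>Integrability and one-step recursions for the moments\<close>

lemma nonzero_indicator_measurable [measurable]: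
  "i \<ge> 1 \<Longrightarrow> (\<lambda>\<omega>. of_bool (X i \<omega> \<noteq> 0) :: real) \<in> borel_measurable M"
  by (rule measurable_compose[OF X_rv]) auto

lemma nonzero_steps_measurable [measurable]: "nonzero_steps X n \<in> borel_measurable M"
  unfolding nonzero_steps_def[abs_def] by measurable

lemma integrable_nonzero_steps [simp]: "integrable M (nonzero_steps X n)"
  by (rule integrable_const_bound[of _ "real n"])
    (auto simp: nonzero_steps_nonneg nonzero_steps_le)

lemma integrable_nonzero_steps_mult [simp]:
  "integrable M (\<lambda>\<omega>. nonzero_steps X m \<omega> * nonzero_steps X n \<omega>)"
  by (rule integrable_const_bound[of _ "real m * real n"])
    (auto simp: nonzero_steps_nonneg nonzero_steps_le abs_mult intro!: mult_mono)

lemma integrable_next_mult [simp]: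
  "i \<ge> 1 \<Longrightarrow> integrable M (\<lambda>\<omega>. of_bool (X i \<omega> \<noteq> 0) * nonzero_steps X n \<omega>)"
  by (rule integrable_const_bound[of _ "real n"])
    (auto simp: nonzero_steps_nonneg nonzero_steps_le)

lemma integrable_next [simp]:
  "i \<ge> 1 \<Longrightarrow> integrable M (\<lambda>\<omega>. of_bool (X i \<omega> \<noteq> 0) :: real)"
  by (rule integrable_const_bound[of _ 1]) auto

text \<open>The conditional expectation of the next indicator given the past is \<open>(1 - r) / n\<close> times the
  current count; here it is tested against an event of the past.\<close>

lemma expectation_next_indicator:
  assumes n: "n \<ge> 1" and A: "A \<in> past n"
  shows "expectation (\<lambda>\<omega>. of_bool (X (Suc n) \<omega> \<noteq> 0) * indicator A \<omega>)
    = (1 - r) / real n * expectation (\<lambda>\<omega>. nonzero_steps X n \<omega> * indicator A \<omega>)"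
proof -
  have ev: "A \<inter> {\<omega> \<in> space M. X k \<omega> \<noteq> 0} \<in> events" if "k \<ge> 1" for k
    using past_events[OF n A] that by (intro sets.Int nonzero_events) auto
  have *: "expectation (\<lambda>\<omega>. of_bool (X k \<omega> \<noteq> 0) * indicator A \<omega>)
      = prob (A \<inter> {\<omega> \<in> space M. X k \<omega> \<noteq> 0})"
    "integrable M (\<lambda>\<omega>. of_bool (X k \<omega> \<noteq> 0) * indicator A \<omega> :: real)" if "k \<ge> 1" for k
  proof -
    have "integrable M (indicator (A \<inter> {\<omega> \<in> space M. X k \<omega> \<noteq> 0}) :: 'a \<Rightarrow> real)"
      using ev[OF that] by (intro integrable_real_indicator) (auto simp: emeasure_eq_measure)
    moreover have eq: "of_bool (X k \<omega> \<noteq> 0) * indicator A \<omega>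
        = (indicator (A \<inter> {\<omega> \<in> space M. X k \<omega> \<noteq> 0}) \<omega> :: real)" if "\<omega> \<in> space M" for \<omega>
      using that by (auto simp: indicator_def)
    ultimately show "integrable M (\<lambda>\<omega>. of_bool (X k \<omega> \<noteq> 0) * indicator A \<omega> :: real)"
      by (subst Bochner_Integration.integrable_cong[OF refl eq])
    have "expectation (\<lambda>\<omega>. of_bool (X k \<omega> \<noteq> 0) * indicator A \<omega>)
      = expectation (indicator (A \<inter> {\<omega> \<in> space M. X k \<omega> \<noteq> 0}) :: 'a \<Rightarrow> real)"
      by (intro Bochner_Integration.integral_cong refl eq)
    also have "\<dots> = prob (A \<inter> {\<omega> \<in> space M. X k \<omega> \<noteq> 0})"
      using sets.sets_into_space[OF ev[OF that]] by (simp add: Int_absorb2)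
    finally show "expectation (\<lambda>\<omega>. of_bool (X k \<omega> \<noteq> 0) * indicator A \<omega>)
      = prob (A \<inter> {\<omega> \<in> space M. X k \<omega> \<noteq> 0})" .
  qed
  have "expectation (\<lambda>\<omega>. nonzero_steps X n \<omega> * indicator A \<omega>)
      = (\<Sum>k=1..n. expectation (\<lambda>\<omega>. of_bool (X k \<omega> \<noteq> 0) * indicator A \<omega>))"
    unfolding nonzero_steps_def sum_distrib_right
    using *(2) by (intro Bochner_Integration.integral_sum) auto
  then show ?thesis using prob_next_nonzero[OF n A] by (simp add: *(1))
qed

lemma expectation_next:
  assumes "n \<ge> 1"
  shows "expectation (\<lambda>\<omega>. of_bool (X (Suc n) \<omega> \<noteq> 0))
    = (1 - r) / real n * expectation (nonzero_steps X n)"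
proof -
  \<comment> \<open>Testing against the whole space turns the conditional identity into one for
    plain expectations.\<close>
  have "space M \<in> past n" using sets.top[of "vimage_algebra (space M) _ _"] by simp
  from expectation_next_indicator[OF assms this] show ?thesis
    by (simp cong: Bochner_Integration.integral_cong)
qed

text \<open>A count up to time \<open>i\<close> \<le> \<open>n\<close> is a sum of indicators of
  past events, so the identity tested against events extends to it by linearity.\<close>

lemma expectation_next_mult:
  assumes n: "n \<ge> 1" "i \<le> n"
  shows "expectation (\<lambda>\<omega>. of_bool (X (Suc n) \<omega> \<noteq> 0) * nonzero_steps X i \<omega>)
    = (1 - r) / real n * expectation (\<lambda>\<omega>. nonzero_steps X n \<omega> * nonzero_steps X i \<omega>)"
proof -
  define A where "A j = {\<omega> \<in> space M. X j \<omega> \<noteq> 0}" for j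
  have count: "nonzero_steps X i \<omega> = (\<Sum>j=1..i. indicator (A j) \<omega>)" if "\<omega> \<in> space M" for \<omega>
    using that by (simp add: nonzero_steps_def A_def indicator_def)
  have A: "A j \<in> past n" if "j \<in> {1..i}" for j
    unfolding A_def using that n by (intro nonzero_in_past) auto
  have expand: "expectation (\<lambda>\<omega>. f \<omega> * nonzero_steps X i \<omega>)
      = (\<Sum>j=1..i. expectation (\<lambda>\<omega>. f \<omega> * indicator (A j) \<omega>))" if "integrable M f" for f
  proof -
    have "expectation (\<lambda>\<omega>. f \<omega> * nonzero_steps X i \<omega>)
        = expectation (\<lambda>\<omega>. \<Sum>j=1..i. f \<omega> * indicator (A j) \<omega>)"
      by (intro Bochner_Integration.integral_cong) (simp_all add: count sum_distrib_left)
    also have "\<dots> = (\<Sum>j=1..i. expectation (\<lambda>\<omega>. f \<omega> * indicator (A j) \<omega>))"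
      using past_events[OF n(1) A] that
      by (intro Bochner_Integration.integral_sum integrable_real_mult_indicator) auto
    finally show ?thesis .
  qed
  show ?thesis
    by (simp add: expand expectation_next_indicator[OF n(1) A] sum_distrib_left)
qed

lemma expectation_nonzero_steps_Suc:
  assumes "n \<ge> 1"
  shows "expectation (nonzero_steps X (Suc n)) = (1 + (1 - r) / real n) * expectation (nonzero_steps X n)"
  using assms by (simp add: nonzero_steps_Suc[abs_def] expectation_next algebra_simps)

lemma expectation_nonzero_steps_Suc_mult:
  assumes "n \<ge> 1" "i \<le> n"
  shows "expectation (\<lambda>\<omega>. nonzero_steps X (Suc n) \<omega> * nonzero_steps X i \<omega>)
    = (1 + (1 - r) / real n) * expectation (\<lambda>\<omega>. nonzero_steps X n \<omega> * nonzero_steps X i \<omega>)"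
  using assms by (simp add: nonzero_steps_Suc distrib_right expectation_next_mult)

lemma expectation_nonzero_steps_Suc_square:
  assumes "n \<ge> 1"
  shows "expectation (\<lambda>\<omega>. (nonzero_steps X (Suc n) \<omega>)\<^sup>2)
    = (1 + 2 * (1 - r) / real n) * expectation (\<lambda>\<omega>. (nonzero_steps X n \<omega>)\<^sup>2)
      + (1 - r) / real n * expectation (nonzero_steps X n)"
proof -
  \<comment> \<open>Expanding the square; an indicator is its own square, which leaves the last term
    linear.\<close>
  have "expectation (\<lambda>\<omega>. (nonzero_steps X (Suc n) \<omega>)\<^sup>2)
    = expectation (\<lambda>\<omega>. nonzero_steps X n \<omega> * nonzero_steps X n \<omega>
      + 2 * (of_bool (X (Suc n) \<omega> \<noteq> 0) * nonzero_steps X n \<omega>) + of_bool (X (Suc n) \<omega> \<noteq> 0))"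
    by (intro Bochner_Integration.integral_cong)
      (simp_all add: nonzero_steps_Suc power2_eq_square algebra_simps)
  also have "\<dots> = expectation (\<lambda>\<omega>. nonzero_steps X n \<omega> * nonzero_steps X n \<omega>)
      + 2 * expectation (\<lambda>\<omega>. of_bool (X (Suc n) \<omega> \<noteq> 0) * nonzero_steps X n \<omega>)
      + expectation (\<lambda>\<omega>. of_bool (X (Suc n) \<omega> \<noteq> 0))"
    by simp
  finally show ?thesis using assms
    by (simp add: expectation_next expectation_next_mult distrib_right flip: power2_eq_square)
qed

section \<open>Mean, orthogonality and variance of the martingale\<close>

abbreviation "\<alpha> \<equiv> alpha_star r"

text \<open>The martingale has constant mean, equal to its starting value: the probability that the
  first step is nonzero.\<close>

lemma alpha_expectation:
  assumes "n \<ge> 1"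
  shows "\<alpha> n * expectation (nonzero_steps X n) = 1 - r"
  using assms
proof (induction n rule: dec_induct)
  case base
  have [measurable]: "X 1 \<in> measurable M (count_space UNIV)" using X_rv by simp
  have "expectation (nonzero_steps X 1) = expectation (indicator {\<omega> \<in> space M. X 1 \<omega> \<noteq> 0})"
    by (intro Bochner_Integration.integral_cong) (auto simp: nonzero_steps_def indicator_def)
  also have "\<dots> = prob {\<omega> \<in> space M. \<not> X 1 \<omega> = 0}" by (simp add: Int_def conj_ac)
  also have "\<dots> = 1 - prob {\<omega> \<in> space M. X 1 \<omega> = 0}"
    by (rule prob_neg) measurable
  finally show ?case using X_first(3) by (simp add: alpha_star_def)
next
  case (step n)
  have "\<alpha> (Suc n) * expectation (nonzero_steps X (Suc n))
      = \<alpha> (Suc n) * (1 + (1 - r) / real n) * expectation (nonzero_steps X n)"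
    using step by (simp add: expectation_nonzero_steps_Suc)
  then show ?case using step by (simp only: alpha_star_Suc_mult r_less_1)
qed

text \<open>Only the later time moves in the induction: the factor at time \<open>n\<close> stays in
  the past, and the growth of the later factor is cancelled by \<open>\<alpha>\<close>. Hence the
  squared L2 distance is a difference of second moments.\<close>

lemma M_star_orthogonal:
  assumes "1 \<le> n" "n \<le> m"
  shows "expectation (\<lambda>\<omega>. M_star r X m \<omega> * M_star r X n \<omega>) = expectation (\<lambda>\<omega>. (M_star r X n \<omega>)\<^sup>2)"
  using assms(2)
proof (induction m rule: dec_induct)
  case base
  show ?case by (simp add: power2_eq_square)
next
  case (step m)
  have E: "expectation (\<lambda>\<omega>. M_star r X k \<omega> * M_star r X n \<omega>)
      = \<alpha> k * \<alpha> n * expectation (\<lambda>\<omega>. nonzero_steps X k \<omega> * nonzero_steps X n \<omega>)" for k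
    by (simp add: M_star_def mult.assoc mult.left_commute[of "nonzero_steps X k _"])
  have m: "m \<ge> 1" using assms(1) step(1) by simp
  have "expectation (\<lambda>\<omega>. M_star r X (Suc m) \<omega> * M_star r X n \<omega>)
      = (\<alpha> (Suc m) * (1 + (1 - r) / real m)) * \<alpha> n
        * expectation (\<lambda>\<omega>. nonzero_steps X m \<omega> * nonzero_steps X n \<omega>)"
    using step m by (simp add: E expectation_nonzero_steps_Suc_mult)
  also have "\<dots> = expectation (\<lambda>\<omega>. M_star r X m \<omega> * M_star r X n \<omega>)"
    using m by (simp only: alpha_star_Suc_mult r_less_1 E)
  finally show ?case using step by simp
qed

text \<open>The normalising factor itself absorbs the variance of a step, so the bound telescopes.\<close>

lemma M_star_second_moment_Suc:
  assumes n: "n \<ge> 1"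
  shows "expectation (\<lambda>\<omega>. (M_star r X (Suc n) \<omega>)\<^sup>2) + \<alpha> (Suc n)
    \<le> expectation (\<lambda>\<omega>. (M_star r X n \<omega>)\<^sup>2) + \<alpha> n"
proof -
  define s where "s = 1 - r"
  define E1 where "E1 = expectation (nonzero_steps X n)"
  define E2 where "E2 = expectation (\<lambda>\<omega>. (nonzero_steps X n \<omega>)\<^sup>2)"
  define a where "a = \<alpha> (Suc n)"
  have s: "0 < s" "s < 1" using params by (auto simp: s_def)
  have a: "a > 0" unfolding a_def by (rule alpha_star_pos[OF r_less_1])
  have an: "\<alpha> n = a * (1 + s / real n)"
    using alpha_star_Suc_mult[OF n r_less_1] by (simp add: a_def s_def)
  have "a \<le> \<alpha> n" unfolding an using a s by (simp add: field_simps)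
  have E1: "\<alpha> n * E1 = s" using alpha_expectation[OF n] by (simp add: E1_def s_def)
  have "E1 \<ge> 0" unfolding E1_def by (intro integral_nonneg_AE) (simp add: nonzero_steps_nonneg)
  have "E2 \<ge> 0" unfolding E2_def by (intro integral_nonneg_AE) simp
  have M2: "expectation (\<lambda>\<omega>. (M_star r X k \<omega>)\<^sup>2)
      = (\<alpha> k)\<^sup>2 * expectation (\<lambda>\<omega>. (nonzero_steps X k \<omega>)\<^sup>2)" for k
    by (simp add: M_star_def power_mult_distrib)
  \<comment> \<open>Completing the square costs only the nonnegative term \<open>(s / n)^2\<close>
    and turns \<open>a\<close> back into \<open>\<alpha> n\<close>.\<close>
  have "a\<^sup>2 * ((1 + 2 * s / real n) * E2) \<le> a\<^sup>2 * ((1 + s / real n)\<^sup>2 * E2)"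
    using \<open>E2 \<ge> 0\<close> by (intro mult_left_mono mult_right_mono) (auto simp: power2_sum)
  also have "\<dots> = (\<alpha> n)\<^sup>2 * E2" by (simp add: an power_mult_distrib)
  finally have 1: "a\<^sup>2 * ((1 + 2 * s / real n) * E2) \<le> (\<alpha> n)\<^sup>2 * E2" .
  \<comment> \<open>The remaining term is \<open>a * s / n\<close> times \<open>a * E1\<close>. Its
    first factor is exactly the decrease of \<open>\<alpha>\<close> at this step, so a bound of 1 on
    the second suffices; it follows from \<open>\<alpha> n * E1 = s < 1\<close>.\<close>
  have "a * E1 \<le> 1"
    using mult_right_mono[OF \<open>a \<le> \<alpha> n\<close> \<open>E1 \<ge> 0\<close>] E1 s by linarith
  then have "a * s / real n * (a * E1) \<le> a * s / real n * 1"
    using a s by (intro mult_left_mono) auto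
  then have 2: "a\<^sup>2 * (s / real n * E1) \<le> \<alpha> n - a"
    by (simp add: an power2_eq_square algebra_simps)
  show ?thesis
    using 1 2 unfolding M2 expectation_nonzero_steps_Suc_square[OF n]
    by (simp add: algebra_simps flip: a_def E1_def E2_def s_def)
qed

lemma M_star_measurable [measurable]: "M_star r X n \<in> borel_measurable M"
  unfolding M_star_def[abs_def] by measurable

lemma integrable_M_star [simp]:
  "integrable M (M_star r X n)"
  "integrable M (\<lambda>\<omega>. M_star r X m \<omega> * M_star r X n \<omega>)"
proof -
  show "integrable M (M_star r X n)" unfolding M_star_def[abs_def] by simp
  have "integrable M (\<lambda>\<omega>. \<alpha> m * \<alpha> n * (nonzero_steps X m \<omega> * nonzero_steps X n \<omega>))" by simp
  then show "integrable M (\<lambda>\<omega>. M_star r X m \<omega> * M_star r X n \<omega>)"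
    by (simp add: M_star_def mult_ac)
qed

text \<open>By orthogonality this is a difference of second moments, and the one-step bounds
  telescope to \<open>\<alpha> n - \<alpha> m\<close>.\<close>

lemma M_star_L2_dist:
  assumes "1 \<le> n" "n \<le> m"
  shows "expectation (\<lambda>\<omega>. (M_star r X m \<omega> - M_star r X n \<omega>)\<^sup>2) \<le> \<alpha> n"
proof -
  have "expectation (\<lambda>\<omega>. (M_star r X m \<omega> - M_star r X n \<omega>)\<^sup>2)
      = expectation (\<lambda>\<omega>. M_star r X m \<omega> * M_star r X m \<omega>
        + M_star r X n \<omega> * M_star r X n \<omega> - 2 * (M_star r X m \<omega> * M_star r X n \<omega>))"
    by (intro Bochner_Integration.integral_cong) (simp_all add: power2_eq_square algebra_simps)
  also have "\<dots> = expectation (\<lambda>\<omega>. (M_star r X m \<omega>)\<^sup>2) - expectation (\<lambda>\<omega>. (M_star r X n \<omega>)\<^sup>2)"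
    using M_star_orthogonal[OF assms] by (simp add: power2_eq_square)
  also have "\<dots> \<le> \<alpha> n - \<alpha> m"
    using assms(2)
  proof (induction m rule: dec_induct)
    case (step m)
    then show ?case using M_star_second_moment_Suc[of m] assms(1) by linarith
  qed simp
  also have "\<dots> \<le> \<alpha> n" using alpha_star_pos[OF r_less_1, of m] by simp
  finally show ?thesis .
qed

lemma M_star_L1_dist:
  assumes "1 \<le> n" "n \<le> m"
  shows "expectation (\<lambda>\<omega>. \<bar>M_star r X m \<omega> - M_star r X n \<omega>\<bar>) \<le> sqrt (\<alpha> n)"
proof (rule expectation_abs_le_sqrt[OF _ _ M_star_L2_dist[OF assms]])
  show "integrable M (\<lambda>\<omega>. (M_star r X m \<omega> - M_star r X n \<omega>)\<^sup>2)"
    by (simp add: power2_eq_square left_diff_distrib right_diff_distrib)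
qed simp

text \<open>Counts increase and \<open>\<alpha>\<close> decreases, so pairing each with the worse
  endpoint bounds the product. The bounds are phrased through the ratio
  \<open>\<alpha> m / \<alpha> l\<close> because it tends to 1 along the chosen times.\<close>

lemma M_star_between:
  assumes "1 \<le> l" "l \<le> n" "n \<le> m"
  shows "\<alpha> m / \<alpha> l * M_star r X l \<omega> \<le> M_star r X n \<omega>"
    and "M_star r X n \<omega> \<le> M_star r X m \<omega> / (\<alpha> m / \<alpha> l)"
proof -
  note pos = alpha_star_pos[OF r_less_1]
  have "\<alpha> m * nonzero_steps X l \<omega> \<le> \<alpha> n * nonzero_steps X n \<omega>"
    using assms by (intro mult_mono alpha_star_antimono nonzero_steps_mono r_less_1)
      (auto simp: nonzero_steps_nonneg less_imp_le[OF pos])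
  then show "\<alpha> m / \<alpha> l * M_star r X l \<omega> \<le> M_star r X n \<omega>"
    using pos[of l] by (simp add: M_star_def)
  have "\<alpha> n * nonzero_steps X n \<omega> \<le> \<alpha> l * nonzero_steps X m \<omega>"
    using assms by (intro mult_mono alpha_star_antimono nonzero_steps_mono r_less_1)
      (auto simp: nonzero_steps_nonneg less_imp_le[OF pos])
  then show "M_star r X n \<omega> \<le> M_star r X m \<omega> / (\<alpha> m / \<alpha> l)"
    using pos[of m] by (simp add: M_star_def mult.commute)
qed

section \<open>Existence of the limit\<close>

lemma M_star_limit:
  obtains Y where "Y \<in> borel_measurable M" "integrable M Y"
    "AE \<omega> in M. (\<lambda>n. M_star r X n \<omega>) \<longlonglongrightarrow> Y \<omega>"
    "\<And>n. n \<ge> 1 \<Longrightarrow> expectation (\<lambda>\<omega>. \<bar>M_star r X n \<omega> - Y \<omega>\<bar>) \<le> sqrt (\<alpha> n)"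
proof -
  obtain a :: nat where "4 / (1 - r) \<le> real a" using real_arch_simple by blast
  then have a: "real a * (1 - r) \<ge> 4" using r_less_1 by (simp add: pos_divide_le_eq)
  have "a \<ge> 1" using a by (cases a) auto
  \<comment> \<open>Using \<open>Suc k\<close> keeps all times at least 1, as the moment bounds
    require.\<close>
  define g where "g k = Suc k ^ a" for k
  have g: "strict_mono g"
    using \<open>a \<ge> 1\<close> by (auto simp: strict_mono_def g_def intro!: power_strict_mono)
  have g1: "g k \<ge> 1" for k by (simp add: g_def)
  \<comment> \<open>Taking \<open>lim\<close> at every point makes \<open>Y\<close> measurable
    outright; where the sequence diverges its value is irrelevant.\<close>
  define Y where "Y \<omega> = lim (\<lambda>k. M_star r X (g k) \<omega>)" for \<omega>
  have Y: "Y \<in> borel_measurable M"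
    unfolding Y_def[abs_def] by (intro borel_measurable_lim_metric M_star_measurable)
  have "AE \<omega> in M. convergent (\<lambda>k. M_star r X (g k) \<omega>)"
  proof (rule AE_convergent_summable_L1)
    show "expectation (\<lambda>\<omega>. \<bar>M_star r X (g (Suc k)) \<omega> - M_star r X (g k) \<omega>\<bar>) \<le> sqrt (\<alpha> (g k))" for k
      using g g1 by (intro M_star_L1_dist) (auto simp: strict_mono_less_eq)
    show "summable (\<lambda>k. sqrt (\<alpha> (g k)))"
      unfolding g_def by (rule alpha_star_sqrt_summable[OF r_less_1 a])
  qed simp
  then have sub: "AE \<omega> in M. (\<lambda>k. M_star r X (g k) \<omega>) \<longlonglongrightarrow> Y \<omega>"
    by (auto simp: Y_def convergent_LIMSEQ_iff)
  have ratio: "(\<lambda>k. \<alpha> (g (Suc k)) / \<alpha> (g k)) \<longlonglongrightarrow> 1"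
    unfolding g_def by (rule alpha_star_ratio[OF r_less_1 \<open>a \<ge> 1\<close>])
  have conv: "AE \<omega> in M. (\<lambda>n. M_star r X n \<omega>) \<longlonglongrightarrow> Y \<omega>"
    using sub
  proof eventually_elim
    case (elim \<omega>)
    show ?case
    proof (rule tendsto_between_subseq[OF g])
      show "(\<lambda>k. \<alpha> (g (Suc k)) / \<alpha> (g k) * M_star r X (g k) \<omega>) \<longlonglongrightarrow> Y \<omega>"
        using tendsto_mult[OF ratio elim] by simp
      show "(\<lambda>k. M_star r X (g (Suc k)) \<omega> / (\<alpha> (g (Suc k)) / \<alpha> (g k))) \<longlonglongrightarrow> Y \<omega>"
        using tendsto_divide[OF LIMSEQ_Suc[OF elim] ratio] by simp
    qed (use g1 M_star_between in blast)
  qed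
  have L1: "\<forall>\<^sub>F k in sequentially. expectation (\<lambda>\<omega>. \<bar>M_star r X n \<omega> - M_star r X k \<omega>\<bar>) \<le> sqrt (\<alpha> n)"
    if "n \<ge> 1" for n
    using eventually_ge_at_top[of n]
    by eventually_elim (use M_star_L1_dist[OF that] in \<open>simp add: abs_minus_commute\<close>)
  \<comment> \<open>Here \<open>h\<close> is \<open>M_star r X n\<close> for a fixed
    \<open>n\<close>, and the approximating sequence is \<open>M_star r X\<close> itself.\<close>
  note lim = L1_dist_limit_le[OF integrable_M_star(1) integrable_M_star(1) Y conv L1]
  show thesis
  proof (rule that[OF Y _ conv])
    show "integrable M Y" by (rule lim(1)[of 1]) (auto simp: less_imp_le[OF alpha_star_pos[OF r_less_1]])
    show "expectation (\<lambda>\<omega>. \<bar>M_star r X n \<omega> - Y \<omega>\<bar>) \<le> sqrt (\<alpha> n)" if "n \<ge> 1" for n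
      using that by (intro lim(2)) (auto simp: less_imp_le[OF alpha_star_pos[OF r_less_1]])
  qed
qed

end

section \<open>Transfer from the martingale to the scaled counts\<close>

theorem theorem3p1:
  fixes M :: "'a measure"
    and p q r :: real
    and X :: "nat \<Rightarrow> 'a \<Rightarrow> int"
    and K :: "nat \<Rightarrow> 'a \<Rightarrow> nat"
    and S :: "nat \<Rightarrow> 'a \<Rightarrow> int"
  assumes "elephant_walk M p q r X K S"
  shows "\<exists>Y :: 'a \<Rightarrow> real. Y \<in> borel_measurable M
    \<and> (AE \<omega> in M. (\<lambda>n. M_star r X n \<omega>) \<longlonglongrightarrow> Y \<omega>)
    \<and> (\<forall>n\<ge>1. \<forall>\<omega>\<in>space M. nonzero_steps X n \<omega> / real n powr (1 - r)
          = (real n - zero_steps X n \<omega>) / real n powr (1 - r))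
    \<and> (AE \<omega> in M. (\<lambda>n. nonzero_steps X n \<omega> / real n powr (1 - r)) \<longlonglongrightarrow> Y \<omega> / Gamma (2 - r))
    \<and> tendsto_L1 M (M_star r X) Y
    \<and> tendsto_L1 M (\<lambda>n \<omega>. nonzero_steps X n \<omega> / real n powr (1 - r)) (\<lambda>\<omega>. Y \<omega> / Gamma (2 - r))
    \<and> (\<forall>n\<ge>1. (\<integral>\<omega>. nonzero_steps X n \<omega> / real n powr (1 - r) \<partial>M)
          = (\<integral>\<omega>. (real n - zero_steps X n \<omega>) / real n powr (1 - r) \<partial>M))
    \<and> (\<lambda>n. \<integral>\<omega>. nonzero_steps X n \<omega> / real n powr (1 - r) \<partial>M) \<longlonglongrightarrow> 1 / Gamma (1 - r)"
proof -
  interpret elephant_walk M p q r X K S by (rule assms)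
  obtain Y where Y: "Y \<in> borel_measurable M" "integrable M Y"
    "AE \<omega> in M. (\<lambda>n. M_star r X n \<omega>) \<longlonglongrightarrow> Y \<omega>"
    "\<And>n. n \<ge> 1 \<Longrightarrow> expectation (\<lambda>\<omega>. \<bar>M_star r X n \<omega> - Y \<omega>\<bar>) \<le> sqrt (\<alpha> n)"
    by (rule M_star_limit) (rule that)
  define c where "c n = \<alpha> n * real n powr (1 - r)" for n
  have c: "c \<longlonglongrightarrow> Gamma (2 - r)"
    unfolding c_def by (rule alpha_star_asymp[OF r_less_1])
  have G: "Gamma (2 - r) > 0" using r_less_1 by (intro Gamma_real_pos) simp
  \<comment> \<open>Every claim about scaled counts becomes one about the martingale divided by the
    convergent sequence \<open>c\<close>. For \<open>n = 0\<close> both sides are 0.\<close>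
  have scaled: "nonzero_steps X n \<omega> / real n powr (1 - r) = M_star r X n \<omega> / c n" for n \<omega>
    using alpha_star_pos[OF r_less_1, of n] by (simp add: M_star_def c_def)
  have L1: "tendsto_L1 M (M_star r X) Y"
    unfolding tendsto_L1_def
  proof (intro conjI allI impI)
    have sqrt_lim: "(\<lambda>n. sqrt (\<alpha> n)) \<longlonglongrightarrow> 0"
      using tendsto_real_sqrt[OF alpha_star_tendsto_0[OF r_less_1]] by simp
    show "(\<lambda>n. expectation (\<lambda>\<omega>. \<bar>M_star r X n \<omega> - Y \<omega>\<bar>)) \<longlonglongrightarrow> 0"
    proof (rule tendsto_sandwich[OF _ _ tendsto_const sqrt_lim])
      show "\<forall>\<^sub>F n in sequentially. 0 \<le> expectation (\<lambda>\<omega>. \<bar>M_star r X n \<omega> - Y \<omega>\<bar>)" by simp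
      show "\<forall>\<^sub>F n in sequentially. expectation (\<lambda>\<omega>. \<bar>M_star r X n \<omega> - Y \<omega>\<bar>) \<le> sqrt (\<alpha> n)"
        using eventually_ge_at_top[of 1] by eventually_elim (rule Y(4))
    qed
  qed (simp_all add: Y(2))
  \<comment> \<open>For \<open>n\<close> \<ge> 1 the mean of the scaled count is exactly
    \<open>(1 - r) / c n\<close>, so its limit follows from that of \<open>c\<close>.\<close>
  have "(\<lambda>n. (1 - r) / c n) \<longlonglongrightarrow> (1 - r) / Gamma (2 - r)"
    using G by (intro tendsto_intros c) simp
  also have "(1 - r) / Gamma (2 - r) = 1 / Gamma (1 - r)"
  proof -
    have "1 - r \<notin> \<int>\<^sub>\<le>\<^sub>0" using r_less_1 by (auto elim!: nonpos_Ints_cases)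
    from Gamma_plus1[OF this] show ?thesis using r_less_1 by simp
  qed
  finally have mean: "(\<lambda>n. expectation (\<lambda>\<omega>. nonzero_steps X n \<omega> / real n powr (1 - r)))
      \<longlonglongrightarrow> 1 / Gamma (1 - r)"
  proof (rule Lim_transform_eventually)
    show "\<forall>\<^sub>F n in sequentially.
        (1 - r) / c n = expectation (\<lambda>\<omega>. nonzero_steps X n \<omega> / real n powr (1 - r))"
      using eventually_ge_at_top[of 1]
    proof eventually_elim
      case (elim n)
      then show ?case
        using alpha_expectation[OF elim] by (simp add: scaled) (simp add: M_star_def[abs_def])
    qed
  qed
  have AE_scaled: "AE \<omega> in M. (\<lambda>n. nonzero_steps X n \<omega> / real n powr (1 - r)) \<longlonglongrightarrow> Y \<omega> / Gamma (2 - r)"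
    unfolding scaled using Y(3) by eventually_elim (rule tendsto_divide[OF _ c], use G in auto)
  have L1_scaled: "tendsto_L1 M (\<lambda>n \<omega>. nonzero_steps X n \<omega> / real n powr (1 - r))
      (\<lambda>\<omega>. Y \<omega> / Gamma (2 - r))"
    unfolding scaled using G by (intro tendsto_L1_divide L1 c) simp
  show ?thesis
    by (intro exI[of _ Y] conjI Y(1,3) L1 mean AE_scaled L1_scaled)
      (simp_all add: nonzero_steps_eq_diff)
qed

end
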